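(* Let $\mathcal{H}$ be a complex Hilbert space, $T_2,T_3\in\mathcal{L}(\mathcal{H})$ and $q\in(0,1]$. Then $$w_q\left(\begin{bmatrix} O & T_2 \\ {} T_3 & O \end{bmatrix}\right)\ge\max\{w_q(T_2),w_q(T_3)\}-\left(\sqrt{1-\frac{3q^2}{4}+q\sqrt{1-q^2}}\right)\min\{\|T_2+T_3\|,\|T_2-T_3\|\}.$$
   Context: $\mathcal{L}(\mathcal{H})$ is the algebra of bounded linear operators on the complex Hilbert space $\mathcal{H}$, with operator norm $\|\cdot\|$. For $q\in\mathbb{C}$ with $|q|\le 1$, the $q$-numerical radius of a bounded operator $T$ on a Hilbert space $\mathcal{K}$ is $w_q(T)=\sup\{|\langle Tx,y\rangle| : x,y\in\mathcal{K},\ \|x\|=\|y\|=1,\ \langle x,y\rangle=q\}$. When $|q|<1$ it is understood that $\dim\mathcal{H}\ge 2$, so that this supremum is over a nonempty set. A $2\times2$ operator matrix with entries in $\mathcal{L}(\mathcal{H})$ acts on the Hilbert space direct sum $\mathcal{H}\oplus\mathcal{H}$; $O$ is the zero operator. *)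

theory Defs
  imports "HOL-Analysis.Analysis"
begin

class complex_vector = real_vector +
  fixes scaleC :: "complex \<Rightarrow> 'a \<Rightarrow> 'a"  (infixr "*\<^sub>C" 75)
  assumes scaleC_add_right: "a *\<^sub>C (x + y) = a *\<^sub>C x + a *\<^sub>C y"
    and scaleC_add_left: "(a + b) *\<^sub>C x = a *\<^sub>C x + b *\<^sub>C x"
    and scaleC_scaleC: "a *\<^sub>C (b *\<^sub>C x) = (a * b) *\<^sub>C x"
    and scaleC_of_real: "complex_of_real r *\<^sub>C x = r *\<^sub>R x"

global_interpretation complex_vector:
  vector_space "scaleC :: complex \<Rightarrow> 'a \<Rightarrow> 'a::complex_vector"
proof
  show "1 *\<^sub>C x = x" for x :: 'a
    using scaleC_of_real [of 1 x] by simp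
qed (simp_all add: scaleC_add_right scaleC_add_left scaleC_scaleC)

text \<open>The inner product is linear in its first argument. The last axiom gives positive
  definiteness as well as the compatibility of the norm with the inner product.\<close>

class complex_inner = complex_vector + real_normed_vector +
  fixes cinner :: "'a \<Rightarrow> 'a \<Rightarrow> complex"
  assumes cinner_commute: "cinner x y = cnj (cinner y x)"
    and cinner_add_left: "cinner (x + y) z = cinner x z + cinner y z"
    and cinner_scaleC_left: "cinner (a *\<^sub>C x) y = a * cinner x y"
    and cinner_self: "cinner x x = complex_of_real ((norm x)\<^sup>2)"

class chilbert_space = complex_inner + complete_space

text \<open>The Hilbert space direct sum is the product type; the library's norm on products,
  \<open>sqrt ((norm x)\<^sup>2 + (norm y)\<^sup>2)\<close>, is the one induced by \<open>cinner\<close> below.\<close>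

instantiation prod :: (complex_vector, complex_vector) complex_vector
begin

definition scaleC_prod :: "complex \<Rightarrow> 'a \<times> 'b \<Rightarrow> 'a \<times> 'b" where
  "scaleC_prod a p = (a *\<^sub>C fst p, a *\<^sub>C snd p)"

instance
  by standard
    (simp_all add: scaleC_prod_def scaleC_add_right scaleC_add_left scaleC_scaleC
      scaleC_of_real scaleR_prod_def)

end

instantiation prod :: (complex_inner, complex_inner) complex_inner
begin

definition cinner_prod :: "'a \<times> 'b \<Rightarrow> 'a \<times> 'b \<Rightarrow> complex" where
  "cinner_prod p r = cinner (fst p) (fst r) + cinner (snd p) (snd r)"

instance
proof
  fix x y z :: "'a \<times> 'b" and a :: complex
  show "cinner x y = cnj (cinner y x)"
    using cinner_commute [of "fst x" "fst y"] cinner_commute [of "snd x" "snd y"]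
    by (simp add: cinner_prod_def)
  show "cinner (x + y) z = cinner x z + cinner y z"
    by (simp add: cinner_prod_def cinner_add_left)
  show "cinner (a *\<^sub>C x) y = a * cinner x y"
    by (simp add: cinner_prod_def scaleC_prod_def cinner_scaleC_left algebra_simps)
  show "cinner x x = complex_of_real ((norm x)\<^sup>2)"
    by (simp add: cinner_prod_def cinner_self norm_prod_def)
qed

end

instance prod :: (chilbert_space, chilbert_space) chilbert_space ..

locale bounded_clinear = bounded_linear f
  for f :: "'a::complex_inner \<Rightarrow> 'b::complex_inner" +
  assumes scaleC: "f (a *\<^sub>C x) = a *\<^sub>C f x"

definition op_matrix ::
  "('a \<Rightarrow> 'a) \<Rightarrow> ('a \<Rightarrow> 'a) \<Rightarrow> ('a \<Rightarrow> 'a) \<Rightarrow> ('a \<Rightarrow> 'a) \<Rightarrow> 'a \<times> 'a \<Rightarrow> 'a::plus \<times> 'a" where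
  "op_matrix A B C D = (\<lambda>(x, y). (A x + B y, C x + D y))"

text \<open>Meaningful when the supremum is over a nonempty set that is bounded above, i.e. for
  bounded \<open>T\<close> and \<open>cmod q \<le> 1\<close>, on a nonzero space if \<open>cmod q = 1\<close> and on a space
  of complex dimension at least 2 if \<open>cmod q < 1\<close>.\<close>

definition q_numerical_radius :: "complex \<Rightarrow> ('a::complex_inner \<Rightarrow> 'a) \<Rightarrow> real" where
  "q_numerical_radius q T =
    Sup {cmod (cinner (T x) y) | x y. norm x = 1 \<and> norm y = 1 \<and> cinner x y = q}"

end

(* For <x,y> = q the unit vectors (x, wx)/sqrt 2 and (y, wy)/sqrt 2 with |w| = 1 again have inner
   product q, and on them the form of [O, A; B, O] is (w <Ax,y> + cnj w <Bx,y>)/2. The choices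
   w = 1 and w = i bound both |<(A+B)x,y>|/2 and |<(A-B)x,y>|/2 by the q-numerical radius of the
   matrix. As A = (A+B)/2 + (A-B)/2, the q-numerical radius of A exceeds that of the matrix by at
   most min ||A+B||, ||A-B|| times 1/2, and 1/2 is a lower bound for the constant in the theorem. *)

theory Submission
  imports Defs
begin

lemma cinner_add_right: "cinner x (y + z) = cinner x y + cinner x z"
  by (metis cinner_add_left cinner_commute complex_cnj_add)

lemma cinner_scaleC_right: "cinner x (a *\<^sub>C y) = cnj a * cinner x y"
  by (metis cinner_scaleC_left cinner_commute complex_cnj_mult)

lemma scaleC_minus1: "(- 1) *\<^sub>C x = - x"
  using scaleC_of_real [of "- 1" x] by simp

lemma cinner_minus_left: "cinner (- x) y = - cinner x y"
  using cinner_scaleC_left [of "- 1" x y] by (simp add: scaleC_minus1)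

lemma cinner_diff_left: "cinner (x - y) z = cinner x z - cinner y z"
  using cinner_add_left [of x "- y" z] by (simp add: cinner_minus_left)

text \<open>The class axioms give homogeneity of the norm for real scalars only. The complex case is
  read off from \<open>cinner_self\<close>, since
  \<open>cinner (a *\<^sub>C x) (a *\<^sub>C x)\<close> is \<open>a * cnj a\<close> times the square
  of the norm of \<open>x\<close>.\<close>

lemma norm_scaleC:
  fixes x :: "'a::complex_inner"
  shows "norm (a *\<^sub>C x) = cmod a * norm x"
proof -
  have "complex_of_real ((norm (a *\<^sub>C x))\<^sup>2) = a * cnj a * complex_of_real ((norm x)\<^sup>2)"
    by (simp only: cinner_self [symmetric] cinner_scaleC_left cinner_scaleC_right mult_ac)
  also have "\<dots> = complex_of_real ((cmod a * norm x)\<^sup>2)"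
    by (simp only: complex_norm_square [symmetric] power_mult_distrib of_real_mult)
  finally have "(norm (a *\<^sub>C x))\<^sup>2 = (cmod a * norm x)\<^sup>2"
    using of_real_eq_iff by blast
  then show ?thesis by simp
qed

lemma norm_add_square:
  fixes x y :: "'a::complex_inner"
  shows "(norm (x + y))\<^sup>2 = (norm x)\<^sup>2 + 2 * Re (cinner x y) + (norm y)\<^sup>2"
proof -
  have "Re (cinner (x + y) (x + y)) = Re (cinner x x) + 2 * Re (cinner x y) + Re (cinner y y)"
    using cinner_commute [of y x] by (simp add: cinner_add_left cinner_add_right)
  then show ?thesis by (simp only: cinner_self Re_complex_of_real)
qed

text \<open>The triangle inequality is already an axiom of normed spaces, so the usual derivation
  runs backwards: rotating \<open>x\<close> by the unimodular \<open>c\<close> makes the inner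
  product real and nonnegative, and squaring the triangle inequality for
  \<open>c *\<^sub>C x + y\<close> leaves exactly the mixed terms.\<close>

lemma cinner_Cauchy_Schwarz: "cmod (cinner x y) \<le> norm x * norm y"
proof (cases "cinner x y = 0")
  case False
  define c where "c = cnj (sgn (cinner x y))"
  have c: "cmod c = 1" using False by (simp add: c_def norm_sgn)
  have "c * cinner x y = complex_of_real (cmod (cinner x y))"
    using False
    by (simp add: c_def sgn_eq complex_norm_square [symmetric] power2_eq_square field_simps)
  then have "Re (cinner (c *\<^sub>C x) y) = cmod (cinner x y)"
    by (simp add: cinner_scaleC_left)
  moreover have "(norm (c *\<^sub>C x + y))\<^sup>2 \<le> (norm (c *\<^sub>C x) + norm y)\<^sup>2"
    by (intro power_mono norm_triangle_ineq) auto
  ultimately show ?thesis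
    by (simp add: norm_add_square norm_scaleC c power2_sum)
qed simp

text \<open>Gram-Schmidt turns the two independent vectors into an orthonormal pair
  \<open>x\<close>, \<open>e\<close>, and \<open>y\<close> is sought in their span. For
  \<open>q < 1\<close> this shows that the suprema on the space itself run over nonempty
  sets.\<close>

lemma unit_vectors_with_cinner:
  fixes B :: "'h::complex_inner set" and q :: real
  assumes "card B = 2" "complex_vector.independent B" "0 \<le> q" "q \<le> 1"
  obtains x y :: 'h where "norm x = 1" "norm y = 1" "cinner x y = complex_of_real q"
proof -
  obtain u v where B: "B = {u, v}" "u \<noteq> v"
    using assms(1) by (meson card_2_iff)
  have u0: "u \<noteq> 0"
    using assms(2) B complex_vector.dependent_zero by blast
  define x where "x = complex_of_real (1 / norm u) *\<^sub>C u"
  define z where "z = v - cinner v x *\<^sub>C x"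
  have nx: "norm x = 1" using u0 by (simp add: x_def norm_scaleC norm_divide)
  then have xx: "cinner x x = 1" by (simp add: cinner_self)
  have zx: "cinner z x = 0"
    by (simp add: z_def cinner_diff_left cinner_scaleC_left xx)
  have "z \<noteq> 0"
  proof
    assume "z = 0"
    then have "v \<in> complex_vector.span {u}"
      by (simp add: z_def x_def complex_vector.span_singleton scaleC_scaleC)
    moreover have "B - {v} = {u}" using B by auto
    ultimately show False
      using assms(2) B unfolding complex_vector.dependent_def by auto
  qed
  define e where "e = complex_of_real (1 / norm z) *\<^sub>C z"
  have ne: "norm e = 1" using \<open>z \<noteq> 0\<close> by (simp add: e_def norm_scaleC norm_divide)
  have "cinner e x = 0" by (simp add: e_def cinner_scaleC_left zx)
  then have xe: "cinner x e = 0" using cinner_commute [of x e] by simp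
  \<comment> \<open>The coefficient of \<open>x\<close> is the prescribed inner product; the one of
    \<open>e\<close> then makes \<open>y\<close> a unit vector by Pythagoras.\<close>
  define y where "y = complex_of_real q *\<^sub>C x + complex_of_real (sqrt (1 - q\<^sup>2)) *\<^sub>C e"
  have "q\<^sup>2 \<le> 1" using assms by (simp add: power_le_one)
  then have "(norm y)\<^sup>2 = 1"
    unfolding y_def norm_add_square
    by (simp add: norm_scaleC nx ne cinner_scaleC_left cinner_scaleC_right xe)
  then have "norm y = 1" by (simp add: power2_eq_1_iff) (smt (verit) norm_ge_zero)
  moreover have "cinner x y = complex_of_real q"
    by (simp add: y_def cinner_add_right cinner_scaleC_right xx xe)
  ultimately show ?thesis using that nx by blast
qed

text \<open>The norms are only bounded by 1, so that the estimate also applies to the components of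
  a unit vector of the direct sum.\<close>

lemma norm_cinner_le_onorm:
  assumes "bounded_linear T" "norm x \<le> 1" "norm y \<le> 1"
  shows "cmod (cinner (T x) y) \<le> onorm T"
proof -
  have "cmod (cinner (T x) y) \<le> norm (T x) * norm y" by (rule cinner_Cauchy_Schwarz)
  also have "\<dots> \<le> norm (T x)" using assms(3) by (simp add: mult_left_le)
  also have "\<dots> \<le> onorm T * norm x" by (rule onorm [OF assms(1)])
  also have "\<dots> \<le> onorm T"
    using assms(2) onorm_pos_le [OF assms(1)] by (simp add: mult_left_le)
  finally show ?thesis .
qed

text \<open>A real supremum dominates its elements only if the set is bounded above. Here the form
  splits into \<open>cinner (A b) c + cinner (B a) d\<close>, so the sum of the two operator norms
  is a bound.\<close>

lemma norm_cinner_op_matrix_le_q_numerical_radius: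
  fixes A B :: "'h::complex_inner \<Rightarrow> 'h"
  assumes "bounded_linear A" "bounded_linear B"
    and "norm X = 1" "norm Y = 1" "cinner X Y = q"
  shows "cmod (cinner (op_matrix (\<lambda>_. 0) A B (\<lambda>_. 0) X) Y)
    \<le> q_numerical_radius q (op_matrix (\<lambda>_. 0) A B (\<lambda>_. 0))"
  unfolding q_numerical_radius_def
proof (rule cSup_upper)
  show "bdd_above {cmod (cinner (op_matrix (\<lambda>_. 0) A B (\<lambda>_. 0) X) Y) | X Y.
      norm X = 1 \<and> norm Y = 1 \<and> cinner X Y = q}"
  proof (rule bdd_aboveI, clarify)
    fix a b c d :: 'h
    assume 1: "norm (a, b) = 1" "norm (c, d) = 1"
    have "norm a \<le> 1" "norm b \<le> 1" "norm c \<le> 1" "norm d \<le> 1"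
      using 1 norm_fst_le [of a b] norm_snd_le [of b a] norm_fst_le [of c d] norm_snd_le [of d c]
      by auto
    then have "cmod (cinner (A b) c) \<le> onorm A" "cmod (cinner (B a) d) \<le> onorm B"
      using assms norm_cinner_le_onorm by blast+
    then show "cmod (cinner (op_matrix (\<lambda>_. 0) A B (\<lambda>_. 0) (a, b)) (c, d)) \<le> onorm A + onorm B"
      by (simp add: op_matrix_def cinner_prod_def) (meson add_mono norm_triangle_le)
  qed
qed (use assms in blast)

text \<open>The matrix swaps the components: \<open>A\<close> meets the factor \<open>w\<close> from
  the second component of \<open>X\<close>, while \<open>B\<close> meets \<open>cnj w\<close> from
  that of \<open>Y\<close>. In \<open>cinner X Y\<close> the two factors cancel.\<close>

lemma norm_cinner_combination_le:
  fixes A B :: "'h::complex_inner \<Rightarrow> 'h"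
  assumes "bounded_clinear A" "bounded_clinear B"
    and "norm x = 1" "norm y = 1" "cinner x y = q" and "cmod w = 1"
  shows "cmod (w * cinner (A x) y + cnj w * cinner (B x) y) / 2
    \<le> q_numerical_radius q (op_matrix (\<lambda>_. 0) A B (\<lambda>_. 0))"
proof -
  interpret A: bounded_clinear A by fact
  interpret B: bounded_clinear B by fact
  define r where "r = complex_of_real (1 / sqrt 2)"
  have r: "cmod r = 1 / sqrt 2" "cnj r = r" by (simp_all add: r_def norm_divide)
  have rr: "r * r = 1 / 2"
    unfolding r_def of_real_mult [symmetric] by simp
  have ww: "w * cnj w = 1" using assms(6) complex_norm_square [of w] by simp
  define X where "X = (r *\<^sub>C x, (r * w) *\<^sub>C x)"
  define Y where "Y = (r *\<^sub>C y, (r * w) *\<^sub>C y)"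
  have "norm X = 1" "norm Y = 1"
    using assms by (simp_all add: X_def Y_def norm_prod_def norm_scaleC norm_mult r power_divide)
  moreover have "cinner X Y = q"
  proof -
    have "cinner X Y = (r * r) * (q + (w * cnj w) * q)"
      by (simp add: X_def Y_def cinner_prod_def cinner_scaleC_left cinner_scaleC_right r assms
          algebra_simps)
    then show ?thesis by (simp add: rr ww)
  qed
  ultimately have "cmod (cinner (op_matrix (\<lambda>_. 0) A B (\<lambda>_. 0) X) Y)
      \<le> q_numerical_radius q (op_matrix (\<lambda>_. 0) A B (\<lambda>_. 0))"
    by (intro norm_cinner_op_matrix_le_q_numerical_radius A.bounded_linear_axioms
        B.bounded_linear_axioms)
  moreover have "cinner (op_matrix (\<lambda>_. 0) A B (\<lambda>_. 0) X) Y
      = (r * r) * (w * cinner (A x) y + cnj w * cinner (B x) y)"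
    by (simp add: X_def Y_def op_matrix_def cinner_prod_def A.scaleC B.scaleC
        cinner_scaleC_left cinner_scaleC_right r algebra_simps)
  ultimately show ?thesis by (simp add: rr norm_divide)
qed

lemma norm_cinner_le_q_numerical_radius_op_matrix:
  fixes A B :: "'h::complex_inner \<Rightarrow> 'h"
  assumes AB: "bounded_clinear A" "bounded_clinear B"
    and xy: "norm x = 1" "norm y = 1" "cinner x y = q"
  shows "max (cmod (cinner (A x) y)) (cmod (cinner (B x) y))
    \<le> q_numerical_radius q (op_matrix (\<lambda>_. 0) A B (\<lambda>_. 0))
      + min (onorm (\<lambda>x. A x + B x)) (onorm (\<lambda>x. A x - B x)) / 2"
proof -
  interpret A: bounded_clinear A by fact
  interpret B: bounded_clinear B by fact
  let ?a = "cinner (A x) y" and ?b = "cinner (B x) y"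
  let ?w = "q_numerical_radius q (op_matrix (\<lambda>_. 0) A B (\<lambda>_. 0))"
  have "cmod (?a + ?b) / 2 \<le> ?w"
    using norm_cinner_combination_le [OF AB xy, of 1] by simp
  moreover have "cmod (?a - ?b) / 2 \<le> ?w"
  proof -
    \<comment> \<open>Since \<open>cnj \<i> = - \<i>\<close>, this choice of \<open>w\<close> turns
      the sum into a difference, up to a factor of modulus 1.\<close>
    have "\<i> * ?a + cnj \<i> * ?b = \<i> * (?a - ?b)" by (simp add: algebra_simps)
    then show ?thesis
      using norm_cinner_combination_le [OF AB xy, of \<i>] by (simp add: norm_mult)
  qed
  moreover have "cmod (?a + ?b) \<le> onorm (\<lambda>x. A x + B x)"
    using norm_cinner_le_onorm [of "\<lambda>x. A x + B x" x y] xy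
      bounded_linear_add [OF A.bounded_linear_axioms B.bounded_linear_axioms]
    by (simp add: cinner_add_left)
  moreover have "cmod (?a - ?b) \<le> onorm (\<lambda>x. A x - B x)"
    using norm_cinner_le_onorm [of "\<lambda>x. A x - B x" x y] xy
      bounded_linear_sub [OF A.bounded_linear_axioms B.bounded_linear_axioms]
    by (simp add: cinner_diff_left)
  \<comment> \<open>Of the two terms on the right, the one paired with the smaller operator norm is
    bounded by that norm, and the other by \<open>2 * ?w\<close>.\<close>
  moreover have "2 * cmod ?a \<le> cmod (?a + ?b) + cmod (?a - ?b)"
    using norm_triangle_ineq [of "?a + ?b" "?a - ?b"] by (simp add: norm_mult)
  moreover have "2 * cmod ?b \<le> cmod (?a + ?b) + cmod (?a - ?b)"
    using norm_triangle_ineq4 [of "?a + ?b" "?a - ?b"] by (simp add: norm_mult)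
  ultimately show ?thesis by linarith
qed

theorem theorem2p11:
  fixes T\<^sub>2 T\<^sub>3 :: "'h::chilbert_space \<Rightarrow> 'h" and q :: real
  assumes "bounded_clinear T\<^sub>2" and "bounded_clinear T\<^sub>3"
    and "0 < q" and "q \<le> 1"
    and "q < 1 \<Longrightarrow> \<exists>B :: 'h set. card B = 2 \<and> complex_vector.independent B"
  shows "q_numerical_radius (complex_of_real q) (op_matrix (\<lambda>_. 0) T\<^sub>2 T\<^sub>3 (\<lambda>_. 0))
    \<ge> max (q_numerical_radius (complex_of_real q) T\<^sub>2) (q_numerical_radius (complex_of_real q) T\<^sub>3)
      - sqrt (1 - 3 * q\<^sup>2 / 4 + q * sqrt (1 - q\<^sup>2))
        * min (onorm (\<lambda>x. T\<^sub>2 x + T\<^sub>3 x)) (onorm (\<lambda>x. T\<^sub>2 x - T\<^sub>3 x))"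
proof -
  interpret T2: bounded_clinear T\<^sub>2 by fact
  interpret T3: bounded_clinear T\<^sub>3 by fact
  let ?w = "q_numerical_radius (complex_of_real q)"
  let ?M = "op_matrix (\<lambda>_. 0) T\<^sub>2 T\<^sub>3 (\<lambda>_. 0)"
  let ?m = "min (onorm (\<lambda>x. T\<^sub>2 x + T\<^sub>3 x)) (onorm (\<lambda>x. T\<^sub>2 x - T\<^sub>3 x))"
  let ?c = "sqrt (1 - 3 * q\<^sup>2 / 4 + q * sqrt (1 - q\<^sup>2))"
  have m: "0 \<le> ?m"
    by (simp add: onorm_pos_le bounded_linear_add bounded_linear_sub
        T2.bounded_linear_axioms T3.bounded_linear_axioms)
  have q2: "q\<^sup>2 \<le> 1" using assms by (simp add: power_le_one)
  then have "0 \<le> q * sqrt (1 - q\<^sup>2)" using assms by simp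
  \<comment> \<open>The square root term is nonnegative and \<open>q\<^sup>2 \<le> 1\<close>, so the
    radicand is at least 1 - 3/4.\<close>
  then have "(1 / 2)\<^sup>2 \<le> 1 - 3 * q\<^sup>2 / 4 + q * sqrt (1 - q\<^sup>2)"
    using q2 by (simp add: power2_eq_square)
  then have c: "1 / 2 \<le> ?c" by (rule real_le_rsqrt)
  have "max (?w T\<^sub>2) (?w T\<^sub>3) \<le> ?w ?M + ?m / 2"
  \<comment> \<open>Bounding a supremum from above by \<open>cSup_least\<close> requires a nonempty
    set, hence the case distinction.\<close>
  proof (cases "\<exists>x y :: 'h. norm x = 1 \<and> norm y = 1 \<and> cinner x y = complex_of_real q")
    case True
    have "?w T\<^sub>2 \<le> ?w ?M + ?m / 2"
      unfolding q_numerical_radius_def [of _ T\<^sub>2]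
      using True norm_cinner_le_q_numerical_radius_op_matrix [OF assms(1,2)]
      by (intro cSup_least) auto
    moreover have "?w T\<^sub>3 \<le> ?w ?M + ?m / 2"
      unfolding q_numerical_radius_def [of _ T\<^sub>3]
      using True norm_cinner_le_q_numerical_radius_op_matrix [OF assms(1,2)]
      by (intro cSup_least) auto
    ultimately show ?thesis by simp
  next
    (* Here q = 1 and the space is zero, so all three suprema are the same junk value Sup {}. *)
    case False
    have "q = 1"
      using False assms unit_vectors_with_cinner [of _ q] by (metis less_eq_real_def)
    have zero: "x = 0" for x :: 'h
    proof (rule ccontr)
      assume "x \<noteq> 0"
      then have "norm (sgn x) = 1" by (simp add: norm_sgn)
      moreover from this have "cinner (sgn x) (sgn x) = complex_of_real q"
        using \<open>q = 1\<close> by (simp add: cinner_self)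
      ultimately show False using False by blast
    qed
    have "norm (X :: 'h \<times> 'h) \<noteq> 1" for X
      using zero [of "fst X"] zero [of "snd X"] by (simp add: norm_prod_def)
    moreover have "norm (x :: 'h) \<noteq> 1" for x
      using zero [of x] by simp
    ultimately have "?w T\<^sub>2 = ?w ?M" "?w T\<^sub>3 = ?w ?M"
      by (simp_all add: q_numerical_radius_def)
    then show ?thesis using m by simp
  qed
  moreover have "?m / 2 \<le> ?c * ?m"
    using mult_right_mono [OF c m] by simp
  ultimately show ?thesis by linarith
qed

end
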